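(* For every language $L \in \mathsf{DLIN}$ over alphabet $\Sigma$, membership testing in $L$ is $O(\log |\Sigma|)$-streaming reducible in space $O(\log n)$ to membership testing in $\mathsf{1\text{-}turn\text{-}Dyck}_2$.
   Context: A deterministic linear context-free grammar (DL-CFG) is a context-free grammar $(\Sigma, N, P, S)$ in which every production has the form $A \rightarrow a\omega$ or $A \rightarrow \epsilon$, with $a \in \Sigma$ and $\omega \in (N \cup \{\epsilon\})\Sigma^*$, and such that any two productions $A \rightarrow a\omega$, $A \rightarrow b\omega'$ with the same left-hand side satisfy $a \neq b$. $\mathsf{DLIN}$ is the class of languages generated by DL-CFGs. $\mathsf{1\text{-}turn\text{-}Dyck}_2$ is the language generated by the grammar $S \rightarrow (S) \mid [S] \mid \epsilon$. Streaming reduction: fix alphabets $\Sigma_1,\Sigma_2$. A problem $P_1$ is $f(n)$-streaming reducible to a problem $P_2$ in space $s(n)$ if for every input $x = x_1\cdots x_n \in \Sigma_1^n$ there exist $y_1, \ldots, y_n$ with each $y_i \in \bigcup_{j=1}^{f(n)} \Sigma_2^{j} \cup \{\epsilon\}$ such that: each $y_i$ can be computed from $x_i$ using space $s(n)$ (i.e., by a single left-to-right pass over $x$ that emits $y_i$ upon reading $x_i$ using $s(n)$ working memory), and from a solution of $P_2$ on input $y = y_1\cdots y_n$ a solution of $P_1$ on input $x$ can be computed in space $s(n)$. *)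

theory Defs
  imports Complex_Main "HOL-Library.Landau_Symbols"
begin

section \<open>Context-free grammars\<close>

datatype ('n, 't) sym = Nt 'n | Tm 't

type_synonym ('n, 't) prods = "('n \<times> ('n, 't) sym list) set"

definition derives1 :: "('n, 't) prods \<Rightarrow> ('n, 't) sym list \<Rightarrow> ('n, 't) sym list \<Rightarrow> bool" where
  "derives1 P u v \<longleftrightarrow> (\<exists>l A \<alpha> r. (A, \<alpha>) \<in> P \<and> u = l @ [Nt A] @ r \<and> v = l @ \<alpha> @ r)"

definition lang :: "('n, 't) prods \<Rightarrow> 'n \<Rightarrow> 't list set" where
  "lang P S = {w. (derives1 P)\<^sup>*\<^sup>* [Nt S] (map Tm w)}"

section \<open>Deterministic linear grammars\<close>

definition dl_rhs :: "'t set \<Rightarrow> 'n set \<Rightarrow> ('n, 't) sym list \<Rightarrow> bool" where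
  "dl_rhs \<Sigma> N \<alpha> \<longleftrightarrow>
     \<alpha> = [] \<or>
     (\<exists>a\<in>\<Sigma>. \<exists>w\<in>lists \<Sigma>. \<alpha> = Tm a # map Tm w \<or> (\<exists>B\<in>N. \<alpha> = Tm a # Nt B # map Tm w))"

definition dl_cfg :: "'t set \<Rightarrow> 'n set \<Rightarrow> ('n, 't) prods \<Rightarrow> 'n \<Rightarrow> bool" where
  "dl_cfg \<Sigma> N P S \<longleftrightarrow>
     finite \<Sigma> \<and> finite N \<and> finite P \<and> S \<in> N \<and>
     (\<forall>(A, \<alpha>)\<in>P. A \<in> N \<and> dl_rhs \<Sigma> N \<alpha>) \<and>
     (\<forall>A a b \<omega> \<omega>'. (A, Tm a # \<omega>) \<in> P \<longrightarrow> (A, Tm b # \<omega>') \<in> P \<longrightarrow>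
        (a, \<omega>) \<noteq> (b, \<omega>') \<longrightarrow> a \<noteq> b)"

text \<open>
  A grammar has finitely many nonterminals, so taking them from \<^typ>\<open>nat\<close> loses no language.
\<close>

definition DLIN :: "'t set \<Rightarrow> 't list set set" where
  "DLIN \<Sigma> = {L. \<exists>(N :: nat set) P S. dl_cfg \<Sigma> N P S \<and> L = lang P S}"

text \<open>
  The least \<open>k\<close> such that some deterministic linear grammar for \<open>L\<close> has only right-hand sides
  of length at most \<open>k\<close>. It is meaningful for \<open>L\<close> in \<open>DLIN \<Sigma>\<close> only, and it is what the constant
  hidden in the bound \<open>O(log |\<Sigma>|)\<close> is allowed to depend on: one production can append several
  letters at once.
\<close>

definition dlin_width :: "'t set \<Rightarrow> 't list set \<Rightarrow> nat" where
  "dlin_width \<Sigma> L =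
     (LEAST k. \<exists>(N :: nat set) P S. dl_cfg \<Sigma> N P S \<and> L = lang P S \<and> (\<forall>(A, \<alpha>)\<in>P. length \<alpha> \<le> k))"

datatype bracket = LPar | RPar | LBrack | RBrack

definition one_turn_Dyck2 :: "bracket list set" where
  "one_turn_Dyck2 =
     lang {((), [Tm LPar, Nt (), Tm RPar]), ((), [Tm LBrack, Nt (), Tm RBrack]), ((), [])} ()"

section \<open>Streaming machines\<close>

text \<open>
  A streaming machine is a deterministic Turing machine with a one-way read-only input tape, a
  work tape with cells \<open>0, 1, 2, \<dots>\<close> and a write-only output. In a reduction its input tape
  holds \<open>x\<^sub>1 \<dots> x\<^sub>n\<close> followed by a single cell with the solution of the target problem on the
  emitted word. That cell is unavailable before \<open>x\<^sub>n\<close> has been left behind.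

  A transition depends on the state, the current input cell and the scanned work symbol. It
  gives the new state, the symbol written, the move on the work tape, whether the input
  head advances, and the emitted word. States are the numbers below \<open>nstates\<close>, work symbols
  the numbers below \<open>nsyms\<close>. Symbol 0 is blank, and 1 and 2 are the binary digits 0 and 1.
\<close>

datatype 'a cell = Letter 'a | Solution bool

datatype move = MoveL | MoveR | Stay

record ('a, 'b) machine =
  nstates :: nat
  nsyms :: nat
  start :: nat
  accepting :: "nat set"
  trans :: "nat \<Rightarrow> 'a cell \<Rightarrow> nat \<Rightarrow> nat \<times> nat \<times> move \<times> bool \<times> 'b list"

definition wf_machine :: "'a set \<Rightarrow> 'b set \<Rightarrow> ('a, 'b) machine \<Rightarrow> bool" where
  "wf_machine \<Sigma>\<^sub>1 \<Sigma>\<^sub>2 M \<longleftrightarrow>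
     finite \<Sigma>\<^sub>1 \<and> finite \<Sigma>\<^sub>2 \<and> 3 \<le> nsyms M \<and> start M < nstates M \<and>
     (\<forall>q < nstates M. \<forall>a \<in> Letter ` \<Sigma>\<^sub>1 \<union> range Solution. \<forall>g < nsyms M.
        case trans M q a g of (q', g', m, adv, w) \<Rightarrow>
          q' < nstates M \<and> g' < nsyms M \<and> w \<in> lists \<Sigma>\<^sub>2)"

text \<open>A configuration: state, position of the work head, contents of the work tape.\<close>

type_synonym config = "nat \<times> nat \<times> (nat \<Rightarrow> nat)"

definition state_of :: "config \<Rightarrow> nat" where
  "state_of c = fst c"

definition head_of :: "config \<Rightarrow> nat" where
  "head_of c = fst (snd c)"

fun move_head :: "move \<Rightarrow> nat \<Rightarrow> nat" where
  "move_head MoveL h = h - 1"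
| "move_head MoveR h = h + 1"
| "move_head Stay h = h"

fun step :: "('a, 'b) machine \<Rightarrow> 'a cell \<Rightarrow> config \<Rightarrow> bool \<times> 'b list \<times> config" where
  "step M a (q, h, t) =
     (case trans M q a (t h) of (q', g, m, adv, w) \<Rightarrow> (adv, w, (q', move_head m h, t(h := g))))"

text \<open>
  \<open>scans M s a c w c'\<close>: started in \<open>c\<close> with the input head on \<open>a\<close>, the machine eventually
  advances the input head. By then it has emitted \<open>w\<close>, has only scanned work cells below \<open>s\<close>,
  and is in \<open>c'\<close>.
\<close>

inductive scans ::
  "('a, 'b) machine \<Rightarrow> nat \<Rightarrow> 'a cell \<Rightarrow> config \<Rightarrow> 'b list \<Rightarrow> config \<Rightarrow> bool"
  for M s a where
  scans_advance:
    "head_of c < s \<Longrightarrow> step M a c = (True, w, c') \<Longrightarrow> scans M s a c w c'"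
| scans_stay:
    "head_of c < s \<Longrightarrow> step M a c = (False, w, c') \<Longrightarrow> scans M s a c' w' c'' \<Longrightarrow>
     scans M s a c (w @ w') c''"

inductive pass ::
  "('a, 'b) machine \<Rightarrow> nat \<Rightarrow> config \<Rightarrow> 'a list \<Rightarrow> 'b list list \<Rightarrow> config \<Rightarrow> bool"
  for M s where
  pass_Nil: "pass M s c [] [] c"
| pass_Cons:
    "scans M s (Letter a) c y c' \<Longrightarrow> pass M s c' x ys c'' \<Longrightarrow> pass M s c (a # x) (y # ys) c''"

text \<open>
  The machine is told the input length: initially the work tape holds \<open>n\<close> in binary, least
  significant digit in cell 0. The cells holding it count as work space.
\<close>

definition initial_config :: "('a, 'b) machine \<Rightarrow> nat \<Rightarrow> config" where
  "initial_config M n =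
     (start M, 0, \<lambda>i. if n < 2 ^ i then 0 else if odd (n div 2 ^ i) then 2 else 1)"

section \<open>Streaming reductions\<close>

text \<open>
  A decision problem is a predicate on words. One machine serves all input
  lengths. After the pass it receives the solution on \<open>y = y\<^sub>1 \<dots> y\<^sub>n\<close> and, with the contents of
  its work tape but without a second look at \<open>x\<close>, decides \<open>x\<close> within the same space and without
  further output.
\<close>

definition streaming_reducible ::
  "(nat \<Rightarrow> nat) \<Rightarrow> (nat \<Rightarrow> nat) \<Rightarrow> 'a set \<Rightarrow> ('a list \<Rightarrow> bool) \<Rightarrow> 'b set \<Rightarrow> ('b list \<Rightarrow> bool) \<Rightarrow> bool"
where
  "streaming_reducible f s \<Sigma>\<^sub>1 P\<^sub>1 \<Sigma>\<^sub>2 P\<^sub>2 \<longleftrightarrow>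
     (\<exists>M. wf_machine \<Sigma>\<^sub>1 \<Sigma>\<^sub>2 M \<and>
       (\<forall>n. \<forall>x \<in> lists \<Sigma>\<^sub>1. length x = n \<longrightarrow>
         (\<exists>ys c c'.
            length ys = n \<and>
            (\<forall>y \<in> set ys. y \<in> lists \<Sigma>\<^sub>2 \<and> length y \<le> f n) \<and>
            pass M (s n) (initial_config M n) x ys c \<and>
            scans M (s n) (Solution (P\<^sub>2 (concat ys))) c [] c' \<and>
            (state_of c' \<in> accepting M \<longleftrightarrow> P\<^sub>1 x))))"

end

theory Submission
  imports Defs "HOL-Library.Countable_Set"
begin

text \<open>
  In \<open>S \<Rightarrow> a\<^sub>1 B\<^sub>1 w\<^sub>1 \<Rightarrow> a\<^sub>1 a\<^sub>2 B\<^sub>2 w\<^sub>2 w\<^sub>1 \<Rightarrow> \<dots>\<close> the productions are forced by the letters read, except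
  for the point where the derivation stops, and that point is determined by the length \<open>n\<close> of the
  input: after \<open>i\<close> letters it can only stop if \<open>n - i - |w\<^sub>i \<dots> w\<^sub>1| = 0\<close>. The machine keeps this number
  in binary on its tape, decreasing it by \<open>1 + |w\<^sub>i|\<close> with each letter. It emits the reversal of \<open>w\<^sub>i\<close>
  as opening brackets, and once the counter reaches 0 it emits the remaining input as closing
  brackets, so that the result is a Dyck word iff the remaining input is \<open>w\<^sub>i \<dots> w\<^sub>1\<close>. Letters are coded
  by \<open>\<lceil>log |\<Sigma>|\<rceil>\<close> bits each. For \<open>|\<Sigma>| \<le> 1\<close> nothing is emitted, and the counter alone decides.
\<close>

section \<open>Linear grammars\<close>

lemma derives1_Nt: "derives1 P [Nt A] v \<longleftrightarrow> (A, v) \<in> P"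
proof -
  have "l @ [Nt B] @ r = [Nt A] \<longleftrightarrow> l = [] \<and> B = A \<and> r = []" for l r :: "('a, 'b) sym list" and B
    by (cases l) auto
  then show ?thesis
    unfolding derives1_def by (metis append_Nil append_Nil2)
qed

lemma derives1_Nil: "\<not> derives1 P [] v"
  by (auto simp: derives1_def)

text \<open>Only nonterminals are rewritten, so terminals at either border can be stripped from a
  derivation. This isolates the single nonterminal of a linear sentential form.\<close>

lemma derives1_Cons_Tm: "derives1 P (Tm a # u) v \<longleftrightarrow> (\<exists>v'. derives1 P u v' \<and> v = Tm a # v')"
proof
  assume "derives1 P (Tm a # u) v"
  then obtain l A \<alpha> r where *: "(A, \<alpha>) \<in> P" "Tm a # u = l @ [Nt A] @ r" "v = l @ \<alpha> @ r"
    unfolding derives1_def by blast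
  then obtain l' where "l = Tm a # l'" "u = l' @ [Nt A] @ r"
    by (cases l) auto
  with * show "\<exists>v'. derives1 P u v' \<and> v = Tm a # v'"
    unfolding derives1_def by auto
next
  assume "\<exists>v'. derives1 P u v' \<and> v = Tm a # v'"
  then show "derives1 P (Tm a # u) v"
    unfolding derives1_def by (metis append_Cons)
qed

lemma derives1_snoc_Tm: "derives1 P (u @ [Tm a]) v \<longleftrightarrow> (\<exists>v'. derives1 P u v' \<and> v = v' @ [Tm a])"
proof
  assume "derives1 P (u @ [Tm a]) v"
  then obtain l A \<alpha> r where *: "(A, \<alpha>) \<in> P" "u @ [Tm a] = l @ [Nt A] @ r" "v = l @ \<alpha> @ r"
    unfolding derives1_def by blast
  then obtain r' where "r = r' @ [Tm a]" "u = l @ [Nt A] @ r'"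
    by (cases r rule: rev_cases) auto
  with * show "\<exists>v'. derives1 P u v' \<and> v = v' @ [Tm a]"
    unfolding derives1_def by auto
next
  assume "\<exists>v'. derives1 P u v' \<and> v = v' @ [Tm a]"
  then show "derives1 P (u @ [Tm a]) v"
    unfolding derives1_def by (metis append_assoc)
qed

lemma derives_Nil: "(derives1 P)\<^sup>*\<^sup>* [] v \<longleftrightarrow> v = []"
  by (metis converse_rtranclpE derives1_Nil rtranclp.rtrancl_refl)

lemma derives_Cons_Tm:
  "(derives1 P)\<^sup>*\<^sup>* (Tm a # u) v \<longleftrightarrow> (\<exists>v'. (derives1 P)\<^sup>*\<^sup>* u v' \<and> v = Tm a # v')"
proof
  assume "(derives1 P)\<^sup>*\<^sup>* (Tm a # u) v"
  then show "\<exists>v'. (derives1 P)\<^sup>*\<^sup>* u v' \<and> v = Tm a # v'"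
  proof (induction rule: rtranclp_induct)
    case (step y z)
    then show ?case
      by (metis derives1_Cons_Tm rtranclp.rtrancl_into_rtrancl)
  qed auto
next
  have "(derives1 P)\<^sup>*\<^sup>* (Tm a # u) (Tm a # v')" if "(derives1 P)\<^sup>*\<^sup>* u v'" for v'
    using that
  proof (induction rule: rtranclp_induct)
    case (step y z)
    then show ?case
      by (metis derives1_Cons_Tm rtranclp.rtrancl_into_rtrancl)
  qed auto
  then show "\<exists>v'. (derives1 P)\<^sup>*\<^sup>* u v' \<and> v = Tm a # v' \<Longrightarrow> (derives1 P)\<^sup>*\<^sup>* (Tm a # u) v"
    by blast
qed

lemma derives_snoc_Tm:
  "(derives1 P)\<^sup>*\<^sup>* (u @ [Tm a]) v \<longleftrightarrow> (\<exists>v'. (derives1 P)\<^sup>*\<^sup>* u v' \<and> v = v' @ [Tm a])"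
proof
  assume "(derives1 P)\<^sup>*\<^sup>* (u @ [Tm a]) v"
  then show "\<exists>v'. (derives1 P)\<^sup>*\<^sup>* u v' \<and> v = v' @ [Tm a]"
  proof (induction rule: rtranclp_induct)
    case (step y z)
    then show ?case
      by (metis derives1_snoc_Tm rtranclp.rtrancl_into_rtrancl)
  qed auto
next
  have "(derives1 P)\<^sup>*\<^sup>* (u @ [Tm a]) (v' @ [Tm a])" if "(derives1 P)\<^sup>*\<^sup>* u v'" for v'
    using that
  proof (induction rule: rtranclp_induct)
    case (step y z)
    then show ?case
      by (metis derives1_snoc_Tm rtranclp.rtrancl_into_rtrancl)
  qed auto
  then show "\<exists>v'. (derives1 P)\<^sup>*\<^sup>* u v' \<and> v = v' @ [Tm a] \<Longrightarrow> (derives1 P)\<^sup>*\<^sup>* (u @ [Tm a]) v"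
    by blast
qed

lemma derives_append_Tms:
  "(derives1 P)\<^sup>*\<^sup>* (u @ map Tm w) v \<longleftrightarrow> (\<exists>v'. (derives1 P)\<^sup>*\<^sup>* u v' \<and> v = v' @ map Tm w)"
proof (induction w arbitrary: v rule: rev_induct)
  case (snoc a w)
  have "(derives1 P)\<^sup>*\<^sup>* (u @ map Tm (w @ [a])) v \<longleftrightarrow>
      (\<exists>v'. (derives1 P)\<^sup>*\<^sup>* (u @ map Tm w) v' \<and> v = v' @ [Tm a])"
    using derives_snoc_Tm[of P "u @ map Tm w" a v] by simp
  then show ?case
    using snoc.IH by auto
qed auto

text \<open>\<open>None\<close> encodes a right-hand side without nonterminal. In
  \<open>lang_opt\<close> it generates exactly the empty word, so both shapes of production obey one
  formula.\<close>

definition lin_tail :: "'n option \<Rightarrow> 't list \<Rightarrow> ('n, 't) sym list" where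
  "lin_tail B w = (case B of None \<Rightarrow> [] | Some C \<Rightarrow> [Nt C]) @ map Tm w"

definition lang_opt :: "('n, 't) prods \<Rightarrow> 'n option \<Rightarrow> 't list set" where
  "lang_opt P B = (case B of None \<Rightarrow> {[]} | Some C \<Rightarrow> lang P C)"

lemma lin_tail_inject: "lin_tail B w = lin_tail B' w' \<longleftrightarrow> B = B' \<and> w = w'"
proof -
  have "inj (Tm :: 'b \<Rightarrow> ('a, 'b) sym)"
    by (auto simp: inj_on_def)
  then show ?thesis
    by (cases B; cases B'; cases w; cases w') (auto simp: lin_tail_def inj_map_eq_map)
qed

lemma map_Tm_eq_Cons_append_iff:
  "map Tm x = Tm a # v' @ map Tm w \<longleftrightarrow> (\<exists>v. v' = map Tm v \<and> x = a # v @ w)"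
proof
  have inj: "inj (Tm :: 'b \<Rightarrow> ('a, 'b) sym)"
    by (auto simp: inj_on_def)
  assume *: "map Tm x = Tm a # v' @ map Tm w"
  obtain y where y: "x = a # y" "map Tm y = v' @ map Tm w"
    using * by (cases x) simp_all
  obtain v u where "y = v @ u" "v' = map Tm v" "map Tm w = (map Tm u :: ('a, 'b) sym list)"
    using y(2) unfolding map_eq_append_conv by (elim exE conjE) (rule that)
  then show "\<exists>v. v' = map Tm v \<and> x = a # v @ w"
    using y(1) inj by (simp add: inj_map_eq_map)
qed (elim exE conjE, simp)

lemma derives_lin_tail:
  "(derives1 P)\<^sup>*\<^sup>* (Tm a # lin_tail B w) (map Tm x) \<longleftrightarrow> (\<exists>v \<in> lang_opt P B. x = a # v @ w)"
proof -
  let ?R = "(derives1 P)\<^sup>*\<^sup>* (case B of None \<Rightarrow> [] | Some C \<Rightarrow> [Nt C])"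
  have R: "?R (map Tm v) \<longleftrightarrow> v \<in> lang_opt P B" for v
    by (cases B) (simp_all add: lang_opt_def lang_def derives_Nil)
  have "(derives1 P)\<^sup>*\<^sup>* (Tm a # lin_tail B w) (map Tm x) \<longleftrightarrow>
      (\<exists>v'. ?R v' \<and> map Tm x = Tm a # v' @ map Tm w)"
    unfolding lin_tail_def derives_Cons_Tm derives_append_Tms by metis
  also have "\<dots> \<longleftrightarrow> (\<exists>v. ?R (map Tm v) \<and> x = a # v @ w)"
    unfolding map_Tm_eq_Cons_append_iff by metis
  finally show ?thesis
    unfolding R by metis
qed

lemma lang_iff_production:
  "x \<in> lang P A \<longleftrightarrow> (\<exists>\<alpha>. (A, \<alpha>) \<in> P \<and> (derives1 P)\<^sup>*\<^sup>* \<alpha> (map Tm x))"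
proof
  assume "x \<in> lang P A"
  then have "(derives1 P)\<^sup>*\<^sup>* [Nt A] (map Tm x)"
    by (simp add: lang_def)
  then show "\<exists>\<alpha>. (A, \<alpha>) \<in> P \<and> (derives1 P)\<^sup>*\<^sup>* \<alpha> (map Tm x)"
    by (cases rule: converse_rtranclpE) (auto simp: derives1_Nt Cons_eq_map_conv)
next
  assume "\<exists>\<alpha>. (A, \<alpha>) \<in> P \<and> (derives1 P)\<^sup>*\<^sup>* \<alpha> (map Tm x)"
  then show "x \<in> lang P A"
    by (metis (mono_tags, lifting) converse_rtranclp_into_rtranclp derives1_Nt lang_def mem_Collect_eq)
qed

text \<open>Splitting off the first production turns membership into a recursion. It serves twice:
  for the given grammar and for the Dyck grammar, which has the same shape.\<close>

lemma lang_linear_iff: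
  assumes "\<And>\<alpha>. (A, \<alpha>) \<in> P \<Longrightarrow> \<alpha> = [] \<or> (\<exists>a B w. \<alpha> = Tm a # lin_tail B w)"
  shows "x \<in> lang P A \<longleftrightarrow>
    x = [] \<and> (A, []) \<in> P \<or>
    (\<exists>a B w. (A, Tm a # lin_tail B w) \<in> P \<and> (\<exists>v \<in> lang_opt P B. x = a # v @ w))"
    (is "_ \<longleftrightarrow> ?rhs")
proof
  assume "x \<in> lang P A"
  then obtain \<alpha> where \<alpha>: "(A, \<alpha>) \<in> P" "(derives1 P)\<^sup>*\<^sup>* \<alpha> (map Tm x)"
    unfolding lang_iff_production by (elim exE conjE)
  show ?rhs
    using assms[OF \<alpha>(1)]
  proof (elim disjE exE)
    assume "\<alpha> = []"
    then show ?rhs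
      using \<alpha> by (simp add: derives_Nil)
  next
    fix a B w
    assume "\<alpha> = Tm a # lin_tail B w"
    with \<alpha> have "(A, Tm a # lin_tail B w) \<in> P" "\<exists>v \<in> lang_opt P B. x = a # v @ w"
      by (simp_all add: derives_lin_tail)
    then show ?rhs
      by (intro disjI2 exI conjI)
  qed
next
  assume ?rhs
  then show "x \<in> lang P A"
  proof (elim disjE exE conjE)
    assume "x = []" "(A, []) \<in> P"
    then show ?thesis
      unfolding lang_iff_production by (intro exI[of _ "[]"]) simp
  next
    fix a B w
    assume "(A, Tm a # lin_tail B w) \<in> P" "\<exists>v \<in> lang_opt P B. x = a # v @ w"
    then show ?thesis
      unfolding lang_iff_production
      by (intro exI[of _ "Tm a # lin_tail B w"]) (simp add: derives_lin_tail)
  qed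
qed

section \<open>One-turn Dyck words\<close>

fun left_of :: "bool \<Rightarrow> bracket" where
  "left_of True = LPar"
| "left_of False = LBrack"

fun right_of :: "bool \<Rightarrow> bracket" where
  "right_of True = RPar"
| "right_of False = RBrack"

lemma left_right [simp]:
  "left_of b = left_of c \<longleftrightarrow> b = c" "right_of b = right_of c \<longleftrightarrow> b = c"
  "left_of b \<noteq> right_of c" "right_of c \<noteq> left_of b"
  by (cases b; cases c; simp)+

lemma one_turn_Dyck2_iff:
  "y \<in> one_turn_Dyck2 \<longleftrightarrow> y = [] \<or> (\<exists>b. \<exists>u \<in> one_turn_Dyck2. y = left_of b # u @ [right_of b])"
proof -
  define P :: "(unit, bracket) prods" where
    "P = {((), [Tm LPar, Nt (), Tm RPar]), ((), [Tm LBrack, Nt (), Tm RBrack]), ((), [])}"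
  have P: "((), \<alpha>) \<in> P \<longleftrightarrow> \<alpha> = [] \<or> (\<exists>b. \<alpha> = Tm (left_of b) # lin_tail (Some ()) [right_of b])" for \<alpha>
    by (auto simp: P_def lin_tail_def ex_bool_eq)
  have "y \<in> lang P () \<longleftrightarrow> y = [] \<or> (\<exists>b. \<exists>u \<in> lang P (). y = left_of b # u @ [right_of b])"
    by (subst lang_linear_iff) (fastforce simp: P lin_tail_inject lang_opt_def)+
  then show ?thesis
    by (simp add: one_turn_Dyck2_def P_def)
qed

text \<open>Induction peels off the outermost pair: the first opening bracket has to match the last
  closing one, so the closing bits spell the opening bits backwards.\<close>

lemma left_right_in_Dyck:
  "map left_of bs @ map right_of cs \<in> one_turn_Dyck2 \<longleftrightarrow> cs = rev bs"
proof (induction bs arbitrary: cs)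
  case Nil
  then show ?case
    by (subst one_turn_Dyck2_iff) (auto simp: map_eq_Cons_conv)
next
  case (Cons b bs)
  have *: "map left_of (b # bs) @ map right_of cs \<in> one_turn_Dyck2 \<longleftrightarrow>
      (\<exists>u \<in> one_turn_Dyck2. map left_of bs @ map right_of cs = u @ [right_of b])"
    by (subst one_turn_Dyck2_iff) auto
  show ?case
  proof (cases cs rule: rev_cases)
    case Nil
    then show ?thesis
      unfolding * by (cases bs rule: rev_cases) auto
  next
    case (snoc cs' c)
    then show ?thesis
      unfolding * using Cons.IH[of cs'] by auto
  qed
qed

section \<open>Machines with symbolic states\<close>

definition machine_of ::
  "'s set \<Rightarrow> nat \<Rightarrow> 's \<Rightarrow> 's set \<Rightarrow>
   ('s \<Rightarrow> 'a cell \<Rightarrow> nat \<Rightarrow> 's \<times> nat \<times> move \<times> bool \<times> 'b list) \<Rightarrow> ('a, 'b) machine" where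
  "machine_of Q k q\<^sub>0 F tr =
     \<lparr>nstates = card Q, nsyms = k, start = to_nat_on Q q\<^sub>0, accepting = to_nat_on Q ` F,
      trans = (\<lambda>q a g. case tr (from_nat_into Q q) a g of (q', r) \<Rightarrow> (to_nat_on Q q', r))\<rparr>"

lemma to_nat_on_less_card: "finite Q \<Longrightarrow> q \<in> Q \<Longrightarrow> to_nat_on Q q < card Q"
  using to_nat_on_finite[of Q] by (auto simp: bij_betw_def)

lemma wf_machine_of:
  assumes "finite \<Sigma>" "finite \<Delta>" "3 \<le> k" "finite Q" "q\<^sub>0 \<in> Q"
    and "\<And>q a g. q \<in> Q \<Longrightarrow> a \<in> Letter ` \<Sigma> \<union> range Solution \<Longrightarrow> g < k \<Longrightarrow>
      case tr q a g of (q', g', m, adv, w) \<Rightarrow> q' \<in> Q \<and> g' < k \<and> w \<in> lists \<Delta>"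
  shows "wf_machine \<Sigma> \<Delta> (machine_of Q k q\<^sub>0 F tr)"
proof -
  have "case trans (machine_of Q k q\<^sub>0 F tr) q a g of (q', g', m, adv, w) \<Rightarrow>
      q' < card Q \<and> g' < k \<and> w \<in> lists \<Delta>"
    if "a \<in> Letter ` \<Sigma> \<union> range Solution" "g < k" for q a g
  proof -
    \<comment> \<open>\<open>from_nat_into\<close> lands in the nonempty set \<open>Q\<close> for
      every number, even one that codes no state.\<close>
    have "from_nat_into Q q \<in> Q"
      using assms(5) by (intro from_nat_into) auto
    from assms(6)[OF this that] show ?thesis
      using to_nat_on_less_card[OF assms(4)] by (auto simp: machine_of_def split: prod.splits)
  qed
  then show ?thesis
    using assms(1-5) to_nat_on_less_card[OF assms(4,5)]
    by (simp add: wf_machine_def machine_of_def)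
qed

lemma step_machine_of:
  assumes "finite Q" "q \<in> Q"
  shows "step (machine_of Q k q\<^sub>0 F tr) a (to_nat_on Q q, h, t) =
    (case tr q a (t h) of (q', g, m, adv, w) \<Rightarrow>
      (adv, w, (to_nat_on Q q', move_head m h, t(h := g))))"
  using assms by (simp add: machine_of_def countable_finite split: prod.splits)

section \<open>Binary numbers on the work tape\<close>

text \<open>Symbols 3 and 4 are the digits 0 and 1 again, marking the left end of the tape.\<close>

definition digit :: "nat \<Rightarrow> nat" where
  "digit g = (if even g then 1 else 0)"

fun tape_num :: "(nat \<Rightarrow> nat) \<Rightarrow> nat \<Rightarrow> nat \<Rightarrow> nat" where
  "tape_num t h 0 = 0"
| "tape_num t h (Suc k) = digit (t h) + 2 * tape_num t (Suc h) k"

lemma tape_num_cong: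
  "(\<And>i. h \<le> i \<Longrightarrow> i < h + k \<Longrightarrow> t i = t' i) \<Longrightarrow> tape_num t h k = tape_num t' h k"
  by (induction k arbitrary: h) auto

text \<open>The number \<open>l\<close> of digit cells stays fixed while the value falls, so leading
  zeros are allowed. Cell 0 may be marked or not: the initial tape carries no mark, and the first
  sweep sets it. The blank in cell \<open>l\<close> ends each sweep to the right.\<close>

definition represents :: "nat \<Rightarrow> (nat \<Rightarrow> nat) \<Rightarrow> nat \<Rightarrow> bool" where
  "represents l t r \<longleftrightarrow> 0 < l \<and> t 0 \<in> {1..4} \<and> (\<forall>i \<in> {1..<l}. t i \<in> {1, 2}) \<and> t l = 0 \<and> tape_num t 0 l = r"

lemma represents_initial:
  assumes "2 ^ l \<le> n" "n < 2 ^ Suc l"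
  shows "represents (Suc l) (snd (snd (initial_config M n))) n"
proof -
  define t :: "nat \<Rightarrow> nat" where
    "t = (\<lambda>i. if n < 2 ^ i then 0 else if odd (n div 2 ^ i) then 2 else 1)"
  have pos: "2 ^ i \<le> n" if "i \<le> l" for i
    using assms(1) power_increasing[OF that, of "2::nat"] by linarith
  \<comment> \<open>The digits from cell \<open>h\<close> upwards have the value
    \<open>n div 2 ^ h\<close>; the case \<open>h = 0\<close> is the claim.\<close>
  have num: "h + k = Suc l \<Longrightarrow> tape_num t h k = n div 2 ^ h" for h k
  proof (induction k arbitrary: h)
    case 0
    then show ?case
      using assms(2) by simp
  next
    case (Suc k)
    have "digit (t h) = n div 2 ^ h mod 2"
      using pos[of h] Suc.prems by (auto simp: t_def digit_def mod_2_eq_odd)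
    moreover have "n div 2 ^ Suc h = n div 2 ^ h div 2"
      by (simp only: power_Suc2 div_mult2_eq)
    ultimately show ?case
      using Suc.IH[of "Suc h"] Suc.prems by (simp del: power_Suc)
  qed
  have "t i \<in> {1, 2}" if "i \<le> l" for i
    using pos[OF that] by (auto simp: t_def)
  moreover have "t (Suc l) = 0"
    using assms(2) by (simp add: t_def)
  ultimately show ?thesis
    using num[of 0 "Suc l"] by (fastforce simp: represents_def initial_config_def t_def[symmetric])
qed

text \<open>The borrow \<open>c\<close> may exceed 1: the whole subtrahend enters as a borrow into the lowest digit.\<close>

definition diff_digit :: "nat \<Rightarrow> nat \<Rightarrow> nat" where
  "diff_digit b c = (b + c) mod 2"

definition borrow_out :: "nat \<Rightarrow> nat \<Rightarrow> nat" where
  "borrow_out b c = (diff_digit b c + c - b) div 2"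

text \<open>The division in \<open>borrow_out\<close> is exact, since \<open>diff_digit b c\<close>
  has the parity of \<open>b + c\<close>. The subtraction does not truncate: for
  \<open>c = 0\<close> the new digit is \<open>b\<close> itself, and otherwise
  \<open>b \<le> c\<close>.\<close>

lemma subtract_column:
  assumes "b < 2"
  shows "b + 2 * borrow_out b c = diff_digit b c + c"
proof -
  have "b = 0 \<or> b = 1"
    using assms by auto
  then show ?thesis
    unfolding borrow_out_def diff_digit_def by (elim disjE; simp; presburger)
qed

lemma diff_digit_less: "diff_digit b c < 2"
  by (simp add: diff_digit_def)

text \<open>Borrows never grow along a sweep, so they stay below the subtrahend and fit into
  finitely many states.\<close>

lemma borrow_out_le: "borrow_out b c \<le> c"
proof (cases "c = 0")
  case True
  then show ?thesis by (simp add: borrow_out_def diff_digit_def)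
next
  case False
  then show ?thesis
    using diff_digit_less[of b c] by (simp add: borrow_out_def)
qed

lemma digit_less: "digit g < 2"
  by (simp add: digit_def)

section \<open>The reduction\<close>

datatype ctl = Push nat | Pop | Reject | Accept

text \<open>In \<open>Sub\<close>, the number is the current borrow, the flag says that all digits
  written so far are 0, and the two controls are those to resume if the difference is zero or
  positive. \<open>Back\<close> carries the control chosen at the blank to the left end.\<close>

datatype st = Ctl ctl | Sub nat bool ctl ctl | Back ctl

locale dl_reduction =
  fixes \<Sigma> :: "'t set" and N :: "nat set" and P :: "(nat, 't) prods" and S :: nat
    and K :: nat and m :: nat and enc :: "'t \<Rightarrow> bool list"
  assumes dl: "dl_cfg \<Sigma> N P S"
    and width: "\<And>A \<alpha>. (A, \<alpha>) \<in> P \<Longrightarrow> length \<alpha> \<le> K"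
    and enc_inj: "inj_on enc \<Sigma>"
    and enc_length: "\<And>a. a \<in> \<Sigma> \<Longrightarrow> length (enc a) = m"
begin

section \<open>Productions forced by the letter read\<close>

lemma production_cases:
  assumes "(A, \<alpha>) \<in> P"
  obtains "\<alpha> = []"
  | a B w where "\<alpha> = Tm a # lin_tail B w" "a \<in> \<Sigma>" "w \<in> lists \<Sigma>" "set_option B \<subseteq> N"
proof -
  have "dl_rhs \<Sigma> N \<alpha>"
    using dl assms by (auto simp: dl_cfg_def)
  then consider "\<alpha> = []" | a w where "\<alpha> = Tm a # map Tm w" "a \<in> \<Sigma>" "w \<in> lists \<Sigma>"
    | a w B where "\<alpha> = Tm a # Nt B # map Tm w" "a \<in> \<Sigma>" "w \<in> lists \<Sigma>" "B \<in> N"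
    unfolding dl_rhs_def by blast
  then show thesis
  proof cases
    case 1
    then show ?thesis by (rule that(1))
  next
    case 2
    then show ?thesis
      by (intro that(2)[of a None w]) (auto simp: lin_tail_def)
  next
    case 3
    then show ?thesis
      by (intro that(2)[of a "Some B" w]) (auto simp: lin_tail_def)
  qed
qed

definition prod_of :: "nat \<Rightarrow> 't \<Rightarrow> (nat option \<times> 't list) option" where
  "prod_of A a =
     (if \<exists>B w. (A, Tm a # lin_tail B w) \<in> P
      then Some (SOME (B, w). (A, Tm a # lin_tail B w) \<in> P) else None)"

text \<open>Determinism makes productions of \<open>A\<close> with the same first letter equal, and
  \<open>lin_tail\<close> is injective, so the chosen pair is the only candidate.\<close>

lemma prod_of_iff: "prod_of A a = Some (B, w) \<longleftrightarrow> (A, Tm a # lin_tail B w) \<in> P"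
proof -
  have det: "(B, w) = (B', w')"
    if "(A, Tm a # lin_tail B w) \<in> P" "(A, Tm a # lin_tail B' w') \<in> P" for B w B' w'
  proof -
    have "\<forall>A a b \<omega> \<omega>'. (A, Tm a # \<omega>) \<in> P \<longrightarrow> (A, Tm b # \<omega>') \<in> P \<longrightarrow> (a, \<omega>) \<noteq> (b, \<omega>') \<longrightarrow> a \<noteq> b"
      using dl unfolding dl_cfg_def by (elim conjE)
    from this[rule_format, OF that] show ?thesis
      by (auto simp: lin_tail_inject)
  qed
  show ?thesis
  proof (cases "\<exists>B w. (A, Tm a # lin_tail B w) \<in> P")
    case True
    define Bw where "Bw = (SOME (B, w). (A, Tm a # lin_tail B w) \<in> P)"
    have "case Bw of (B, w) \<Rightarrow> (A, Tm a # lin_tail B w) \<in> P"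
    proof -
      obtain B' w' where "(A, Tm a # lin_tail B' w') \<in> P"
        using True by (elim exE)
      then show ?thesis
        unfolding Bw_def
        using someI[of "\<lambda>(B, w). (A, Tm a # lin_tail B w) \<in> P" "(B', w')"] by simp
    qed
    moreover have "prod_of A a = Some Bw"
      using True by (simp add: prod_of_def Bw_def)
    ultimately obtain B' w' where *: "prod_of A a = Some (B', w')" "(A, Tm a # lin_tail B' w') \<in> P"
      by (cases Bw) simp
    show ?thesis
    proof
      assume "prod_of A a = Some (B, w)"
      with * show "(A, Tm a # lin_tail B w) \<in> P"
        by simp
    next
      assume "(A, Tm a # lin_tail B w) \<in> P"
      from det[OF this *(2)] show "prod_of A a = Some (B, w)"
        by (simp only: *(1))
    qed
  next
    case False
    then show ?thesis
      by (simp add: prod_of_def)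
  qed
qed

lemma prod_of_props:
  assumes "prod_of A a = Some (B, w)"
  shows "w \<in> lists \<Sigma>" "set_option B \<subseteq> N" "length w < K"
proof -
  have "(A, Tm a # lin_tail B w) \<in> P"
    using assms by (simp add: prod_of_iff)
  moreover from this show "w \<in> lists \<Sigma>" "set_option B \<subseteq> N"
    by (cases rule: production_cases; auto simp: lin_tail_inject)+
  \<comment> \<open>The leading terminal makes the bound strict, so the subtrahend
    \<open>Suc (length w)\<close> is at most \<open>K\<close>.\<close>
  ultimately show "length w < K"
    using width[of A "Tm a # lin_tail B w"] by (simp add: lin_tail_def)
qed

lemma lang_iff:
  "x \<in> lang P A \<longleftrightarrow> x = [] \<and> (A, []) \<in> P \<or>
    (\<exists>a B w. prod_of A a = Some (B, w) \<and> (\<exists>v \<in> lang_opt P B. x = a # v @ w))"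
  unfolding prod_of_iff
proof (rule lang_linear_iff)
  fix \<alpha>
  assume "(A, \<alpha>) \<in> P"
  then show "\<alpha> = [] \<or> (\<exists>a B w. \<alpha> = Tm a # lin_tail B w)"
    by (cases rule: production_cases) auto
qed

lemma Nil_in_lang_iff: "[] \<in> lang P A \<longleftrightarrow> (A, []) \<in> P"
  by (simp add: lang_iff)

lemma Cons_in_lang_iff:
  "a # u \<in> lang P A \<longleftrightarrow>
    (\<exists>B w. prod_of A a = Some (B, w) \<and> (\<exists>v \<in> lang_opt P B. u = v @ w))"
  by (subst lang_iff) auto

section \<open>Coding words as brackets\<close>

definition encs :: "'t list \<Rightarrow> bool list" where
  "encs w = concat (map enc w)"

lemma encs_simps [simp]:
  "encs [] = []" "encs (a # w) = enc a @ encs w" "encs (v @ w) = encs v @ encs w"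
  by (simp_all add: encs_def)

lemma length_encs: "w \<in> lists \<Sigma> \<Longrightarrow> length (encs w) = length w * m"
  by (induction w) (auto simp: enc_length)

text \<open>The length hypothesis is needed because the codes are empty for \<open>m = 0\<close>.\<close>

lemma encs_inject:
  "length v = length w \<Longrightarrow> v \<in> lists \<Sigma> \<Longrightarrow> w \<in> lists \<Sigma> \<Longrightarrow> encs v = encs w \<longleftrightarrow> v = w"
  by (induction v w rule: list_induct2) (auto simp: enc_length dest: inj_onD[OF enc_inj])

text \<open>The reversal makes the bracket opened last, which is closed first, belong to the first
  letter of \<open>w\<close>.\<close>

definition push :: "'t list \<Rightarrow> bracket list" where
  "push w = map left_of (rev (encs w))"

definition pop :: "'t list \<Rightarrow> bracket list" where
  "pop w = map right_of (encs w)"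

text \<open>A later production puts its suffix \<open>w\<close> to the left of the pending suffix
  \<open>W\<close>; accordingly the brackets for \<open>w @ W\<close> arise by emitting those for
  \<open>w\<close> after those for \<open>W\<close>.\<close>

lemma push_append: "push (v @ w) = push w @ push v"
  by (simp add: push_def)

lemma push_pop_in_Dyck:
  "length v = length w \<Longrightarrow> v \<in> lists \<Sigma> \<Longrightarrow> w \<in> lists \<Sigma> \<Longrightarrow>
    push w @ pop v \<in> one_turn_Dyck2 \<longleftrightarrow> v = w"
  by (simp add: push_def pop_def left_right_in_Dyck encs_inject)

section \<open>The counter machine\<close>

text \<open>
  The control component of a counter machine. In state \<open>Push A\<close> with counter \<open>r\<close>, the nonterminal
  \<open>A\<close> still has to produce exactly \<open>r\<close> letters.
\<close>

definition on_zero :: "nat option \<Rightarrow> ctl" where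
  "on_zero B = (if [] \<in> lang_opt P B then Pop else Reject)"

definition on_pos :: "nat option \<Rightarrow> ctl" where
  "on_pos B = (case B of None \<Rightarrow> Reject | Some C \<Rightarrow> Push C)"

text \<open>A production accounts for \<open>Suc (length w)\<close> of the letters due: the one just
  read and its suffix. The subtraction truncates only together with \<open>Reject\<close>.\<close>

fun cstep :: "ctl \<Rightarrow> nat \<Rightarrow> 't \<Rightarrow> bracket list \<times> ctl \<times> nat" where
  "cstep (Push A) r a =
     (case prod_of A a of
        None \<Rightarrow> ([], Reject, r)
      | Some (B, w) \<Rightarrow>
          (push w,
           if r < Suc (length w) then Reject else if r = Suc (length w) then on_zero B else on_pos B,
           r - Suc (length w)))"
| "cstep Pop r a = (pop [a], Pop, r)"
| "cstep q r a = ([], Reject, r)"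

fun crun :: "ctl \<Rightarrow> nat \<Rightarrow> 't list \<Rightarrow> bracket list list \<times> ctl" where
  "crun q r [] = ([], q)"
| "crun q r (a # x) =
     (case cstep q r a of (y, q', r') \<Rightarrow> case crun q' r' x of (ys, q'') \<Rightarrow> (y # ys, q''))"

lemma crun_Pop: "\<exists>ys. crun Pop r x = (ys, Pop) \<and> concat ys = pop x"
proof (induction x)
  case (Cons a x)
  then obtain ys where "crun Pop r x = (ys, Pop)" "concat ys = pop x"
    by blast
  then show ?case
    by (simp add: pop_def)
qed (simp add: pop_def)

lemma crun_Reject: "\<exists>ys. crun Reject r x = (ys, Reject)"
  by (induction x) auto

text \<open>The invariant of the run: \<open>W\<close> is the concatenation of all pending suffixes,
  \<open>push W\<close> has already been emitted, and the remaining input must be \<open>r\<close>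
  letters from \<open>A\<close> followed by \<open>W\<close>. As \<open>r\<close> is positive and
  the input long enough, the run cannot end in a \<open>Push\<close> state.\<close>

lemma crun_correct:
  assumes "0 < r" "length x = r + length W" "x \<in> lists \<Sigma>" "W \<in> lists \<Sigma>"
  shows "\<exists>ys q. crun (Push A) r x = (ys, q) \<and> q \<in> {Pop, Reject} \<and>
    (q = Pop \<and> push W @ concat ys \<in> one_turn_Dyck2 \<longleftrightarrow> take r x \<in> lang P A \<and> drop r x = W)"
  using assms
proof (induction x arbitrary: r A W)
  case Nil
  then show ?case by simp
next
  case (Cons a x)
  then obtain k where k: "r = Suc k"
    by (cases r) auto
  have len: "length x = k + length W"
    using Cons.prems k by simp
  show ?case
  proof (cases "prod_of A a")
    case None
    obtain ys where "crun Reject r x = (ys, Reject)"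
      using crun_Reject by blast
    then show ?thesis
      using None k by (simp add: Cons_in_lang_iff)
  next
    case (Some Bw)
    then obtain B w where Bw: "prod_of A a = Some (B, w)"
      by (cases Bw) auto
    have w: "w \<in> lists \<Sigma>"
      using prod_of_props[OF Bw] by simp
    \<comment> \<open>After \<open>a\<close>, the nonterminal \<open>B\<close> owes
      \<open>k - length w\<close> letters, and the pending suffix grows to
      \<open>w @ W\<close>.\<close>
    have iff: "take r (a # x) \<in> lang P A \<and> drop r (a # x) = W \<longleftrightarrow>
        length w \<le> k \<and> take (k - length w) x \<in> lang_opt P B \<and> drop (k - length w) x = w @ W"
      (is "?L \<longleftrightarrow> ?R")
    proof
      assume ?L
      then obtain v where v: "v \<in> lang_opt P B" "take k x = v @ w" "drop k x = W"
        using Bw k by (auto simp: Cons_in_lang_iff)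
      have "x = v @ w @ W"
        using v append_take_drop_id[of k x] by simp
      moreover have "k = length v + length w"
        using v(2) len by (metis length_append length_take min_absorb2 le_add1)
      ultimately show ?R
        using v by simp
    next
      assume R: ?R
      define v where "v = take (k - length w) x"
      have x: "x = v @ w @ W"
        using R append_take_drop_id[of "k - length w" x] by (simp add: v_def)
      then have "k = length v + length w"
        using len by simp
      then show ?L
        using x R Bw k by (auto simp: Cons_in_lang_iff v_def[symmetric])
    qed
    define k' where "k' = k - length w"
    consider (under) "k < length w" | (zero) "k = length w" | (pos) "length w < k"
      by linarith
    then show ?thesis
    proof cases
      case under
      obtain ys where "crun Reject (r - Suc (length w)) x = (ys, Reject)"
        using crun_Reject by blast
      then show ?thesis
        unfolding iff using under k Bw by simp
    next
      case zero
      show ?thesis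
      proof (cases "[] \<in> lang_opt P B")
        case True
        obtain ys where "crun Pop 0 x = (ys, Pop)" "concat ys = pop x"
          using crun_Pop by blast
        \<comment> \<open>The turn: everything still unread is closed against the pending
          suffixes.\<close>
        moreover have "push (w @ W) @ pop x \<in> one_turn_Dyck2 \<longleftrightarrow> x = w @ W"
          using Cons.prems w len zero by (intro push_pop_in_Dyck) auto
        ultimately show ?thesis
          unfolding iff using zero k Bw True by (simp add: on_zero_def push_append)
      next
        case False
        obtain ys where "crun Reject 0 x = (ys, Reject)"
          using crun_Reject by blast
        then show ?thesis
          unfolding iff using zero k Bw False by (simp add: on_zero_def)
      qed
    next
      case pos
      show ?thesis
      proof (cases B)
        case None
        obtain ys where "crun Reject k' x = (ys, Reject)"
          using crun_Reject by blast
        \<comment> \<open>Without a nonterminal the block would have to be empty, yet letters are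
          still due.\<close>
        moreover have "take k' x \<noteq> []"
          using pos len by (auto simp: k'_def)
        ultimately show ?thesis
          unfolding iff using pos k Bw None by (simp add: on_pos_def lang_opt_def k'_def)
      next
        case (Some C)
        have "\<exists>ys q. crun (Push C) k' x = (ys, q) \<and> q \<in> {Pop, Reject} \<and>
            (q = Pop \<and> push (w @ W) @ concat ys \<in> one_turn_Dyck2 \<longleftrightarrow>
             take k' x \<in> lang P C \<and> drop k' x = w @ W)"
          using Cons.prems pos len w by (intro Cons.IH) (auto simp: k'_def)
        then obtain ys q where "crun (Push C) k' x = (ys, q)" "q \<in> {Pop, Reject}"
            "q = Pop \<and> push (w @ W) @ concat ys \<in> one_turn_Dyck2 \<longleftrightarrow>
             take k' x \<in> lang P C \<and> drop k' x = w @ W"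
          by blast
        then show ?thesis
          unfolding iff using pos k Bw Some
          by (simp add: on_pos_def lang_opt_def k'_def push_append)
      qed
    qed
  qed
qed

text \<open>A push codes fewer than \<open>K\<close> letters and a pop exactly one;
  \<open>Suc K\<close> covers both, even for \<open>K = 0\<close>.\<close>

lemma crun_emits:
  assumes "x \<in> lists \<Sigma>" "crun q r x = (ys, q')"
  shows "length ys = length x" "\<And>y. y \<in> set ys \<Longrightarrow> length y \<le> Suc K * m"
proof -
  have cstep: "length y \<le> Suc K * m" if "cstep q r a = (y, q', r')" "a \<in> \<Sigma>" for q r a y q' r'
  proof (cases q)
    case (Push A)
    show ?thesis
    proof (cases "prod_of A a")
      case (Some Bw)
      then obtain B w where Bw: "prod_of A a = Some (B, w)"
        by (cases Bw) auto
      have "length (push w) = length w * m"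
        using prod_of_props(1)[OF Bw] length_encs by (simp add: push_def)
      also have "\<dots> \<le> Suc K * m"
        using prod_of_props(3)[OF Bw] by (intro mult_right_mono) auto
      finally show ?thesis
        using that Push Bw by auto
    qed (use that Push in auto)
  qed (use that in \<open>auto simp: pop_def enc_length\<close>)
  have "length ys = length x \<and> (\<forall>y \<in> set ys. length y \<le> Suc K * m)"
    using assms
  proof (induction x arbitrary: q r ys)
    case (Cons a x)
    then show ?case
      using cstep by (fastforce split: prod.splits)
  qed auto
  then show "length ys = length x" "\<And>y. y \<in> set ys \<Longrightarrow> length y \<le> Suc K * m"
    by auto
qed

section \<open>The Turing machine and its simulation of the counter\<close>

text \<open>
  The counter is decremented by a sweep to the right that subtracts and tests for zero, followed by
  a sweep back to the marked cell.
\<close>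

fun tr :: "st \<Rightarrow> 't cell \<Rightarrow> nat \<Rightarrow> st \<times> nat \<times> move \<times> bool \<times> bracket list" where
  "tr (Ctl (Push A)) (Letter a) g =
     (case prod_of A a of
        None \<Rightarrow> (Ctl Reject, g, Stay, True, [])
      | Some (B, w) \<Rightarrow>
          let b = digit g; c = Suc (length w) in
          (Sub (borrow_out b c) (diff_digit b c = 0) (on_zero B) (on_pos B),
           diff_digit b c + 3, MoveR, False, push w))"
| "tr (Ctl Pop) (Letter a) g = (Ctl Pop, g, Stay, True, pop [a])"
| "tr (Ctl q) (Letter a) g = (Ctl Reject, g, Stay, True, [])"
| "tr (Ctl (Push A)) (Solution b) g =
     (Ctl (if b \<and> (A, []) \<in> P then Accept else Reject), g, Stay, True, [])"
| "tr (Ctl Pop) (Solution b) g = (Ctl (if b then Accept else Reject), g, Stay, True, [])"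
| "tr (Ctl q) (Solution b) g = (Ctl Reject, g, Stay, True, [])"
| "tr (Sub c z q\<^sub>0 q\<^sub>1) a g =
     (if g = 0 then (Back (if 0 < c then Reject else if z then q\<^sub>0 else q\<^sub>1), 0, MoveL, False, [])
      else let b = digit g in
        (Sub (borrow_out b c) (z \<and> diff_digit b c = 0) q\<^sub>0 q\<^sub>1, diff_digit b c + 1, MoveR, False, []))"
| "tr (Back q) a g =
     (if 3 \<le> g then (Ctl q, g, Stay, True, []) else (Back q, g, MoveL, False, []))"

definition ctls :: "ctl set" where
  "ctls = Push ` N \<union> {Pop, Reject, Accept}"

definition states :: "st set" where
  "states = Ctl ` ctls \<union> Back ` ctls \<union>
     (\<lambda>(c, z, q\<^sub>0, q\<^sub>1). Sub c z q\<^sub>0 q\<^sub>1) ` ({..K} \<times> UNIV \<times> ctls \<times> ctls)"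

lemma states_simps [simp]:
  "Ctl q \<in> states \<longleftrightarrow> q \<in> ctls"
  "Back q \<in> states \<longleftrightarrow> q \<in> ctls"
  "Sub c z q\<^sub>0 q\<^sub>1 \<in> states \<longleftrightarrow> c \<le> K \<and> q\<^sub>0 \<in> ctls \<and> q\<^sub>1 \<in> ctls"
  by (auto simp: states_def image_iff)

lemma finite_states: "finite states"
  using dl by (auto simp: states_def ctls_def dl_cfg_def)

lemma ctls_simps [simp]:
  "Pop \<in> ctls" "Reject \<in> ctls" "Accept \<in> ctls" "Push A \<in> ctls \<longleftrightarrow> A \<in> N" "on_zero B \<in> ctls"
  by (auto simp: ctls_def on_zero_def)

lemma on_pos_in_ctls: "prod_of A a = Some (B, w) \<Longrightarrow> on_pos B \<in> ctls"
  using prod_of_props(2)[of A a B w] by (auto simp: on_pos_def split: option.splits)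

text \<open>The five symbols are the blank, two digits and two marked digits.\<close>

definition M :: "('t, bracket) machine" where
  "M = machine_of states 5 (Ctl (Push S)) {Ctl Accept} tr"

abbreviation code :: "st \<Rightarrow> nat" where
  "code \<equiv> to_nat_on states"

lemma wf_M: "wf_machine \<Sigma> UNIV M"
  unfolding M_def
proof (rule wf_machine_of)
  show "finite \<Sigma>" "Ctl (Push S) \<in> states"
    using dl by (auto simp: dl_cfg_def)
  show "finite (UNIV :: bracket set)"
  proof (rule finite_subset)
    show "(UNIV :: bracket set) \<subseteq> {LPar, RPar, LBrack, RBrack}"
      using bracket.exhaust by blast
  qed simp
  show "finite states"
    by (rule finite_states)
next
  fix q :: st and a :: "'t cell" and g :: nat
  assume q: "q \<in> states" and "g < 5"
  have le: "diff_digit b c + 3 < 5" "diff_digit b c + 1 < 5" for b c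
    using diff_digit_less[of b c] by linarith+
  have "borrow_out (digit g) (Suc (length w)) \<le> K" if "prod_of A b = Some (B, w)" for A b B w
    using prod_of_props(3)[OF that] borrow_out_le[of "digit g" "Suc (length w)"] by linarith
  moreover have "borrow_out b c \<le> K" if "c \<le> K" for b c
    using that borrow_out_le[of b c] by linarith
  ultimately show "case tr q a g of (q', g', m, adv, w) \<Rightarrow> q' \<in> states \<and> g' < 5 \<and> w \<in> lists UNIV"
    using q \<open>g < 5\<close> le
    by (cases "(q, a, g)" rule: tr.cases)
       (auto simp: Let_def on_pos_in_ctls split: option.splits)
qed simp

lemma step_M:
  "q \<in> states \<Longrightarrow> step M a (code q, h, t) =
    (case tr q a (t h) of (q', g, m, adv, w) \<Rightarrow> (adv, w, (code q', move_head m h, t(h := g))))"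
  unfolding M_def by (rule step_machine_of[OF finite_states])

lemma scans_now:
  assumes "q \<in> states" "h < s" "tr q a (t h) = (q', g, mv, True, w)"
  shows "scans M s a (code q, h, t) w (code q', move_head mv h, t(h := g))"
  using assms by (intro scans_advance) (simp_all add: step_M head_of_def del: step.simps)

lemma scans_later:
  assumes "q \<in> states" "h < s" "tr q a (t h) = (q', g, mv, False, w)"
    and "scans M s a (code q', move_head mv h, t(h := g)) w' c"
  shows "scans M s a (code q, h, t) (w @ w') c"
  using assms by (intro scans_stay) (simp_all add: step_M head_of_def del: step.simps)

text \<open>The mark is how the machine recognizes cell 0, since a left move from there silently
  leaves the head in place.\<close>

lemma scans_Back:
  assumes "q \<in> ctls" "h < s" "3 \<le> t 0" "\<forall>i \<in> {1..h}. t i < 3"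
  shows "scans M s a (code (Back q), h, t) [] (code (Ctl q), 0, t)"
  using assms
proof (induction h)
  case 0
  then show ?case
    using scans_now[of "Back q" 0 s a t "Ctl q" "t 0" Stay "[]"] by simp
next
  case (Suc h)
  then have "scans M s a (code (Back q), h, t) [] (code (Ctl q), 0, t)"
    by simp
  moreover have "\<not> 3 \<le> t (Suc h)"
    using Suc.prems by (simp add: not_le)
  ultimately show ?case
    using Suc.prems scans_later[of "Back q" "Suc h" s a t "Back q" "t (Suc h)" MoveL "[]" "[]"] by simp
qed

text \<open>As \<open>scans\<close> speaks of runs up to the next input move, the sweep is stated by
  continuation: any run from its end extends to one from its beginning. The digits are specified
  only if the subtraction does not underflow. The flag \<open>z\<close> speaks for the cells left of
  \<open>h\<close>.\<close>

lemma scans_Sub: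
  assumes "c \<le> K" "q\<^sub>0 \<in> ctls" "q\<^sub>1 \<in> ctls" "h + k < s"
    and "\<forall>i \<in> {h..<h + k}. t i \<in> {1, 2}" "t (h + k) = 0"
  shows "\<exists>t'. (\<forall>i. i \<notin> {h..<h + k} \<longrightarrow> t' i = t i) \<and> (\<forall>i \<in> {h..<h + k}. t' i \<in> {1, 2}) \<and>
    (c \<le> tape_num t h k \<longrightarrow> tape_num t' h k = tape_num t h k - c) \<and>
    (\<forall>w cf. scans M s a (code (Back (if tape_num t h k < c then Reject
        else if z \<and> tape_num t h k = c then q\<^sub>0 else q\<^sub>1)), h + k - 1, t') w cf \<longrightarrow>
      scans M s a (code (Sub c z q\<^sub>0 q\<^sub>1), h, t) w cf)"
  using assms
proof (induction k arbitrary: h c z t)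
  case 0
  \<comment> \<open>At the blank the remaining number is 0, so a positive borrow means
    underflow.\<close>
  then have "t(h := 0) = t"
    by auto
  then show ?case
    using 0 scans_later[of "Sub c z q\<^sub>0 q\<^sub>1" h s a t _ 0 MoveL "[]"]
    by (intro exI[of _ t]) (auto split: if_splits)
next
  case (Suc k)
  define b where "b = digit (t h)"
  define b' where "b' = diff_digit b c"
  define c' where "c' = borrow_out b c"
  define u where "u = t(h := b' + 1)"
  have col: "b + 2 * c' = b' + c" "b' < 2"
    unfolding b'_def c'_def by (simp_all add: subtract_column diff_digit_less b_def digit_less)
  define V where "V = tape_num t (Suc h) k"
  have V: "tape_num u (Suc h) k = V"
    unfolding V_def by (rule tape_num_cong) (simp add: u_def)
  have num: "tape_num t h (Suc k) = b + 2 * V"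
    by (simp add: b_def V_def)
  \<comment> \<open>By the column equation, comparing the number with \<open>c\<close> amounts to
    comparing \<open>b' + 2 * V\<close> with \<open>2 * c'\<close>, where
    \<open>b' < 2\<close>.\<close>
  have V_less: "tape_num t h (Suc k) < c \<longleftrightarrow> V < c'"
    and V_eq: "tape_num t h (Suc k) = c \<longleftrightarrow> b' = 0 \<and> V = c'"
    using col unfolding num by presburger+
  have "c' \<le> K"
    using borrow_out_le[of b c] Suc.prems unfolding c'_def by linarith
  have u: "Suc h + k < s" "\<forall>i \<in> {Suc h..<Suc h + k}. u i \<in> {1, 2}" "u (Suc h + k) = 0"
    using Suc.prems(4-6) by (auto simp: u_def)
  obtain t' where t': "\<forall>i. i \<notin> {Suc h..<Suc h + k} \<longrightarrow> t' i = u i"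
      "\<forall>i \<in> {Suc h..<Suc h + k}. t' i \<in> {1, 2}"
      "c' \<le> V \<longrightarrow> tape_num t' (Suc h) k = V - c'"
      "\<forall>w cf. scans M s a (code (Back (if V < c' then Reject
        else if (z \<and> b' = 0) \<and> V = c' then q\<^sub>0 else q\<^sub>1)), Suc h + k - 1, t') w cf \<longrightarrow>
      scans M s a (code (Sub c' (z \<and> b' = 0) q\<^sub>0 q\<^sub>1), Suc h, u) w cf"
    using Suc.IH[OF \<open>c' \<le> K\<close> Suc.prems(2,3) u, of "z \<and> b' = 0"] unfolding V
    by (elim exE conjE) (rule that)
  have h: "t' h = b' + 1"
    using t'(1) by (simp add: u_def)
  then have dig: "digit (t' h) = b'"
    using col(2) by (auto simp: digit_def less_2_cases_iff)
  have "t h \<noteq> 0"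
    using Suc.prems(5) by force
  then have tr: "tr (Sub c z q\<^sub>0 q\<^sub>1) a (t h) = (Sub c' (z \<and> b' = 0) q\<^sub>0 q\<^sub>1, b' + 1, MoveR, False, [])"
    by (simp add: b_def[symmetric] c'_def[symmetric] b'_def[symmetric])
  show ?case
  proof (intro exI[of _ t'] conjI allI impI ballI)
    fix i
    assume "i \<notin> {h..<h + Suc k}"
    then show "t' i = t i"
      using t'(1) by (auto simp: u_def)
  next
    fix i
    assume "i \<in> {h..<h + Suc k}"
    then show "t' i \<in> {1, 2}"
      using t'(2) h col(2) by (cases "i = h") auto
  next
    assume "c \<le> tape_num t h (Suc k)"
    then show "tape_num t' h (Suc k) = tape_num t h (Suc k) - c"
      using t'(3) dig col V_less unfolding num by simp
  next
    fix w cf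
    assume "scans M s a (code (Back (if tape_num t h (Suc k) < c then Reject
        else if z \<and> tape_num t h (Suc k) = c then q\<^sub>0 else q\<^sub>1)), h + Suc k - 1, t') w cf"
    then have "scans M s a (code (Sub c' (z \<and> b' = 0) q\<^sub>0 q\<^sub>1), Suc h, u) w cf"
      unfolding V_less V_eq by (intro t'(4)[rule_format]) (auto simp: conj_assoc split: if_splits)
    then show "scans M s a (code (Sub c z q\<^sub>0 q\<^sub>1), h, t) w cf"
      using Suc.prems tr scans_later[of "Sub c z q\<^sub>0 q\<^sub>1" h s a t _ _ MoveR "[]"]
      by (simp add: u_def)
  qed
qed

text \<open>Cell 0 is treated apart from the sweep because its new digit is written with the mark.
  Only \<open>Push\<close> states consult the counter, so only they require the tape to represent
  it. The sweep scans the blank in cell \<open>l\<close>, whence \<open>l < s\<close>.\<close>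

lemma scans_cstep:
  assumes "a \<in> \<Sigma>" "q \<in> ctls" "l < s" "\<forall>A. q = Push A \<longrightarrow> represents l t r"
    and "cstep q r a = (y, q', r')"
  shows "\<exists>t'. scans M s (Letter a) (code (Ctl q), 0, t) y (code (Ctl q'), 0, t') \<and> q' \<in> ctls \<and>
    (\<forall>A. q' = Push A \<longrightarrow> represents l t' r')"
proof -
  \<comment> \<open>Transitions that advance the input at once and leave the tape alone.\<close>
  have easy: ?thesis
    if "tr (Ctl q) (Letter a) (t 0) = (Ctl q', t 0, Stay, True, y)" "q' \<in> ctls" "\<And>A. q' \<noteq> Push A"
    using scans_now[of "Ctl q" 0 s "Letter a" t, OF _ _ that(1)] that assms(2,3)
    by (intro exI[of _ t]) simp
  consider (push) A B w where "q = Push A" "prod_of A a = Some (B, w)"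
    | (fail) A where "q = Push A" "prod_of A a = None"
    | (other) "\<And>A. q \<noteq> Push A"
    by (cases q) (auto, metis not_None_eq surj_pair)
  then show ?thesis
  proof cases
    case push
    define c where "c = Suc (length w)"
    have rep: "represents l t r"
      using assms(4) push by simp
    then obtain k where k: "l = Suc k"
      by (cases l) (auto simp: represents_def)
    define b where "b = digit (t 0)"
    define b' where "b' = diff_digit b c"
    define c' where "c' = borrow_out b c"
    define u where "u = t(0 := b' + 3)"
    have col: "b + 2 * c' = b' + c" "b' < 2"
      unfolding b'_def c'_def by (simp_all add: subtract_column diff_digit_less b_def digit_less)
    define V where "V = tape_num t (Suc 0) k"
    have r: "r = b + 2 * V"
      using rep by (simp add: represents_def k b_def V_def)
    have V: "tape_num u (Suc 0) k = V"
      unfolding V_def by (rule tape_num_cong) (simp add: u_def)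
    have V_less: "r < c \<longleftrightarrow> V < c'" and V_eq: "r = c \<longleftrightarrow> b' = 0 \<and> V = c'"
      using col unfolding r by presburger+
    have "c' \<le> K"
      using borrow_out_le[of b c] prod_of_props(3)[OF push(2)] unfolding c'_def c_def by linarith
    \<comment> \<open>The sweep starts in cell 1 with the borrow out of cell 0; its flag records
      whether the digit just written is 0.\<close>
    from scans_Sub[OF this _ on_pos_in_ctls[OF push(2)], of "on_zero B" "Suc 0" k s u "Letter a" "b' = 0"]
    obtain t' where t': "\<forall>i. i \<notin> {Suc 0..<Suc 0 + k} \<longrightarrow> t' i = u i"
        "\<forall>i \<in> {Suc 0..<Suc 0 + k}. t' i \<in> {1, 2}"
        "c' \<le> V \<longrightarrow> tape_num t' (Suc 0) k = V - c'"
        "\<And>w cf. scans M s (Letter a) (code (Back (if V < c' then Reject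
          else if b' = 0 \<and> V = c' then on_zero B else on_pos B)), k, t') w cf \<Longrightarrow>
        scans M s (Letter a) (code (Sub c' (b' = 0) (on_zero B) (on_pos B)), Suc 0, u) w cf"
      unfolding V using assms(3) rep by (auto simp: u_def k represents_def)
    have t'0: "t' 0 = b' + 3"
      using t'(1) by (simp add: u_def)
    then have dig: "digit (t' 0) = b'"
      using col(2) by (auto simp: digit_def less_2_cases_iff)
    have "cstep q r a =
        (push w, if r < c then Reject else if r = c then on_zero B else on_pos B, r - c)"
      using push by (simp add: c_def)
    then have q': "y = push w" "r' = r - c"
        "q' = (if V < c' then Reject else if b' = 0 \<and> V = c' then on_zero B else on_pos B)"
      using assms(5) unfolding V_less V_eq by simp_all
    have "q' \<in> ctls"
      using q'(3) on_pos_in_ctls[OF push(2)] by simp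
    moreover have "scans M s (Letter a) (code (Back q'), k, t') [] (code (Ctl q'), 0, t')"
    proof (rule scans_Back)
      show "\<forall>i \<in> {1..k}. t' i < 3"
      proof
        fix i
        assume "i \<in> {1..k}"
        then have "t' i \<in> {1, 2}"
          using t'(2) by simp
        then show "t' i < 3"
          by auto
      qed
    qed (use \<open>q' \<in> ctls\<close> assms(3) t'0 k in auto)
    then have "scans M s (Letter a) (code (Sub c' (b' = 0) (on_zero B) (on_pos B)), Suc 0, u) []
        (code (Ctl q'), 0, t')"
      using t'(4) q'(3) by simp
    then have "scans M s (Letter a) (code (Ctl q), 0, t) (push w @ []) (code (Ctl q'), 0, t')"
      using assms(2,3) push unfolding u_def
      by (intro scans_later)
        (auto simp: c_def[symmetric] b_def[symmetric] c'_def[symmetric] b'_def[symmetric])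
    moreover have "represents l t' r'" if "q' = Push A'" for A'
    proof -
      \<comment> \<open>Reaching another \<open>Push\<close> state rules out underflow, so the new
        digits are the exact difference.\<close>
      have "\<not> r < c"
        using that q'(3) V_less by auto
      then have "tape_num t' 0 l = r'"
        using t'(3) V_less r dig col q'(2) by (simp add: k)
      moreover have "t' l = 0"
        using t'(1) rep k by (auto simp: represents_def u_def)
      ultimately show ?thesis
        using t'(2) t'0 col(2) by (auto simp: represents_def k)
    qed
    ultimately show ?thesis
      using q'(1) by auto
  next
    case fail
    then show ?thesis
      using assms(5) by (intro easy) auto
  next
    case other
    then show ?thesis
      using assms(5) by (intro easy; cases q) auto
  qed
qed

lemma pass_crun:
  assumes "x \<in> lists \<Sigma>" "q \<in> ctls" "l < s" "\<forall>A. q = Push A \<longrightarrow> represents l t r"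
    and "crun q r x = (ys, q')"
  shows "\<exists>t'. pass M s (code (Ctl q), 0, t) x ys (code (Ctl q'), 0, t') \<and> q' \<in> ctls"
  using assms
proof (induction x arbitrary: q t r ys rule: list.induct)
  case Nil
  then show ?case
    by (auto intro: pass_Nil)
next
  case (Cons a x)
  obtain y q1 r1 where c: "cstep q r a = (y, q1, r1)"
    by (metis prod_cases3)
  obtain ys1 where ys: "crun q1 r1 x = (ys1, q')" "ys = y # ys1"
    using Cons.prems c by (auto split: prod.splits)
  obtain t1 where t1: "scans M s (Letter a) (code (Ctl q), 0, t) y (code (Ctl q1), 0, t1)"
      "q1 \<in> ctls" "\<forall>A. q1 = Push A \<longrightarrow> represents l t1 r1"
    using scans_cstep[OF _ Cons.prems(2,3,4) c] Cons.prems(1) by auto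
  obtain t' where "pass M s (code (Ctl q1), 0, t1) x ys1 (code (Ctl q'), 0, t')" "q' \<in> ctls"
    using Cons.IH[OF _ t1(2) Cons.prems(3) t1(3) ys(1)] Cons.prems(1) by auto
  then show ?case
    using t1(1) ys(2) by (auto intro: pass_Cons)
qed

text \<open>In a run from the start, a \<open>Push\<close> state meets the solution cell only for
  empty input, where the production to the empty word decides.\<close>

lemma scans_Solution:
  assumes "q \<in> ctls" "0 < s"
  shows "\<exists>c. scans M s (Solution b) (code (Ctl q), 0, t) [] c \<and>
    (state_of c \<in> accepting M \<longleftrightarrow> b \<and> (q = Pop \<or> (\<exists>A. q = Push A \<and> (A, []) \<in> P)))"
proof -
  define q' where "q' = (if b \<and> (q = Pop \<or> (\<exists>A. q = Push A \<and> (A, []) \<in> P)) then Accept else Reject)"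
  have "tr (Ctl q) (Solution b) (t 0) = (Ctl q', t 0, Stay, True, [])"
    by (cases q) (auto simp: q'_def)
  then have "scans M s (Solution b) (code (Ctl q), 0, t) [] (code (Ctl q'), 0, t)"
    using assms scans_now[of "Ctl q" 0 s "Solution b" t "Ctl q'" "t 0" Stay "[]"] by simp
  moreover have "code (Ctl q') \<in> accepting M \<longleftrightarrow> q' = Accept"
    using to_nat_on_inj[of states "Ctl q'" "Ctl Accept"] finite_states
    by (auto simp: M_def machine_of_def countable_finite q'_def)
  ultimately show ?thesis
    by (intro exI conjI) (auto simp: state_of_def q'_def split: if_splits)
qed

text \<open>An input length with \<open>Suc l\<close> binary digits has its terminating blank in
  cell \<open>Suc l\<close>, which must lie within the space bound. For \<open>n = 0\<close> only
  cell 0 is scanned.\<close>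

theorem streaming_reducible_Dyck:
  assumes "\<And>n l. 2 ^ l \<le> n \<Longrightarrow> Suc l < s n" "\<And>n. 0 < s n"
  shows "streaming_reducible (\<lambda>_. Suc K * m) s \<Sigma> (\<lambda>x. x \<in> lang P S)
    UNIV (\<lambda>y. y \<in> one_turn_Dyck2)"
  unfolding streaming_reducible_def
proof (intro exI[of _ M] conjI wf_M allI ballI impI)
  fix n and x :: "'t list"
  assume x: "x \<in> lists \<Sigma>" and n: "length x = n"
  have S: "Push S \<in> ctls"
    using dl by (simp add: dl_cfg_def)
  define t where "t = snd (snd (initial_config M n))"
  have init: "initial_config M n = (code (Ctl (Push S)), 0, t)"
    by (simp add: initial_config_def t_def M_def machine_of_def)
  define ys where "ys = fst (crun (Push S) n x)"
  define q where "q = snd (crun (Push S) n x)"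
  have run: "crun (Push S) n x = (ys, q)"
    by (simp add: ys_def q_def)
  have "\<exists>t'. pass M (s n) (code (Ctl (Push S)), 0, t) x ys (code (Ctl q), 0, t') \<and> q \<in> ctls"
  proof (cases "n = 0")
    case True
    then show ?thesis
      using n run S by (auto intro: pass_Nil)
  next
    case False
    then obtain l where l: "2 ^ l \<le> n" "n < 2 ^ Suc l"
      using ex_power_ivl1[of 2 n] by auto
    show ?thesis
      using represents_initial[OF l, of M] assms(1)[OF l(1)]
      by (intro pass_crun[OF x S _ _ run]) (auto simp: t_def)
  qed
  then obtain t' where pass: "pass M (s n) (initial_config M n) x ys (code (Ctl q), 0, t')" "q \<in> ctls"
    unfolding init by blast
  obtain c' where c': "scans M (s n) (Solution (concat ys \<in> one_turn_Dyck2)) (code (Ctl q), 0, t') [] c'"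
      "state_of c' \<in> accepting M \<longleftrightarrow>
        concat ys \<in> one_turn_Dyck2 \<and> (q = Pop \<or> (\<exists>A. q = Push A \<and> (A, []) \<in> P))"
    using scans_Solution[OF pass(2) assms(2)] by blast
  have "concat ys \<in> one_turn_Dyck2 \<and> (q = Pop \<or> (\<exists>A. q = Push A \<and> (A, []) \<in> P)) \<longleftrightarrow> x \<in> lang P S"
  proof (cases "n = 0")
    case True
    then show ?thesis
      using n run by (auto simp: Nil_in_lang_iff one_turn_Dyck2_iff[of "[]"])
  next
    case False
    then show ?thesis
      \<comment> \<open>Initially no suffix is pending and the whole input is due from
        \<open>S\<close>.\<close>
      using crun_correct[of n x "[]" S] n x run by (auto simp: push_def)
  qed
  then show "\<exists>ys c c'. length ys = n \<and> (\<forall>y \<in> set ys. y \<in> lists UNIV \<and> length y \<le> Suc K * m) \<and>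
      pass M (s n) (initial_config M n) x ys c \<and>
      scans M (s n) (Solution (concat ys \<in> one_turn_Dyck2)) c [] c' \<and>
      (state_of c' \<in> accepting M \<longleftrightarrow> x \<in> lang P S)"
    using crun_emits[OF x run] n pass(1) c'
    by (intro exI[of _ ys] exI[of _ "(code (Ctl q), 0, t')"] exI[of _ c']) auto
qed

end

section \<open>Code length, grammar width and the final bounds\<close>

lemma ex_fixed_length_code:
  assumes "finite \<Sigma>" "card \<Sigma> \<le> 2 ^ m"
  obtains enc :: "'a \<Rightarrow> bool list" where "inj_on enc \<Sigma>" "\<And>a. a \<in> \<Sigma> \<Longrightarrow> length (enc a) = m"
proof -
  let ?B = "{bs :: bool list. set bs \<subseteq> UNIV \<and> length bs = m}"
  have "card ?B = 2 ^ m" "finite ?B"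
    using card_lists_length_eq[of "UNIV :: bool set" m] finite_lists_length_eq[of "UNIV :: bool set" m]
    by (simp_all add: card_UNIV_bool)
  then obtain enc where "enc ` \<Sigma> \<subseteq> ?B" "inj_on enc \<Sigma>"
    using assms card_le_inj[of \<Sigma> ?B] by auto
  then show thesis
    by (intro that) auto
qed

text \<open>A grammar for \<open>L\<close> has finitely many productions, so some width bound exists
  and the least one is attained.\<close>

lemma DLIN_width_grammar:
  assumes "L \<in> DLIN \<Sigma>"
  obtains N :: "nat set" and P S where "dl_cfg \<Sigma> N P S" "L = lang P S"
    "\<And>A \<alpha>. (A, \<alpha>) \<in> P \<Longrightarrow> length \<alpha> \<le> dlin_width \<Sigma> L"
proof -
  define Q where "Q k \<longleftrightarrow> (\<exists>(N :: nat set) P S. dl_cfg \<Sigma> N P S \<and> L = lang P S \<and>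
    (\<forall>(A, \<alpha>)\<in>P. length \<alpha> \<le> k))" for k
  obtain N :: "nat set" and P S where P: "dl_cfg \<Sigma> N P S" "L = lang P S"
    using assms by (auto simp: DLIN_def)
  have "finite ((length \<circ> snd) ` P)"
    using P(1) by (simp add: dl_cfg_def)
  then obtain k where "\<forall>i \<in> (length \<circ> snd) ` P. i \<le> k"
    using finite_nat_set_iff_bounded_le by blast
  then have "Q k"
    unfolding Q_def using P by fastforce
  then have "Q (LEAST k. Q k)"
    by (rule LeastI)
  then have "Q (dlin_width \<Sigma> L)"
    by (simp add: dlin_width_def Q_def)
  then show thesis
    unfolding Q_def using that by fast
qed

lemma nat_ceiling_log2_card:
  fixes k :: nat
  shows "k \<le> 2 ^ nat \<lceil>log 2 (real k)\<rceil>" "real (nat \<lceil>log 2 (real k)\<rceil>) \<le> 2 * log 2 (real k)"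
proof -
  define m where "m = nat \<lceil>log 2 (real k)\<rceil>"
  \<comment> \<open>For \<open>k \<le> 1\<close> the logarithm is 0, for \<open>k = 0\<close> by
    convention, and so is the code length. For \<open>k \<ge> 2\<close> it is at least 1, and the
    factor 2 absorbs the rounding.\<close>
  consider "k = 0" | "k = 1" | "2 \<le> k"
    by linarith
  then have "k \<le> 2 ^ m \<and> real m \<le> 2 * log 2 (real k)"
  proof cases
    case 3
    have "1 \<le> log 2 (real k)"
      using 3 by (simp add: le_log_iff)
    have m: "log 2 (real k) \<le> real m" "real m \<le> log 2 (real k) + 1"
      unfolding m_def using \<open>1 \<le> log 2 (real k)\<close> by linarith+
    have "real k \<le> 2 powr real m"
      using m(1) 3 by (simp add: log_le_iff)
    then have "real k \<le> real (2 ^ m)"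
      by (simp add: powr_realpow)
    then show ?thesis
      using m \<open>1 \<le> log 2 (real k)\<close> of_nat_le_iff by (auto simp del: of_nat_power)
  qed (auto simp: m_def log_def)
  then show "k \<le> 2 ^ nat \<lceil>log 2 (real k)\<rceil>" "real (nat \<lceil>log 2 (real k)\<rceil>) \<le> 2 * log 2 (real k)"
    by (auto simp: m_def)
qed

theorem theorem11:
  shows "\<exists>C :: nat \<Rightarrow> real. \<forall>(\<Sigma> :: 't set) L. L \<in> DLIN \<Sigma> \<longrightarrow>
    (\<exists>f s. (\<forall>n. real (f n) \<le> C (dlin_width \<Sigma> L) * log 2 (real (card \<Sigma>))) \<and>
           (\<lambda>n. real (s n)) \<in> O(\<lambda>n. log 2 (real n)) \<and>
           streaming_reducible f s \<Sigma> (\<lambda>x. x \<in> L) UNIV (\<lambda>y. y \<in> one_turn_Dyck2))"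
proof (intro exI[of _ "\<lambda>k. 2 * real (Suc k)"] allI impI)
  \<comment> \<open>In the constant, \<open>Suc k\<close> bounds the letters coded per step and 2
    pays for rounding up the code length.\<close>
  fix \<Sigma> :: "'t set" and L
  assume L: "L \<in> DLIN \<Sigma>"
  define K where "K = dlin_width \<Sigma> L"
  define m where "m = nat \<lceil>log 2 (real (card \<Sigma>))\<rceil>"
  \<comment> \<open>A positive \<open>n\<close> has one digit more than the rounded logarithm, and
    the blank after the digits takes one more cell.\<close>
  define s where "s n = nat \<lfloor>log 2 (real n)\<rfloor> + 2" for n :: nat
  obtain N :: "nat set" and P S where P: "dl_cfg \<Sigma> N P S" "L = lang P S"
      "\<And>A \<alpha>. (A, \<alpha>) \<in> P \<Longrightarrow> length \<alpha> \<le> K"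
    using DLIN_width_grammar[OF L] unfolding K_def by blast
  obtain enc :: "'t \<Rightarrow> bool list" where enc: "inj_on enc \<Sigma>" "\<And>a. a \<in> \<Sigma> \<Longrightarrow> length (enc a) = m"
    using ex_fixed_length_code[of \<Sigma> m] P(1) nat_ceiling_log2_card(1)
    by (metis dl_cfg_def m_def)
  interpret dl_reduction \<Sigma> N P S K m enc
    using P enc by unfold_locales auto
  have "Suc l < s n" if "2 ^ l \<le> n" for l n
  proof -
    have "0 < n"
      using that by (metis gr0I not_le zero_less_numeral zero_less_power)
    have "(2::real) ^ l \<le> real n"
      using that by (metis of_nat_le_iff of_nat_numeral of_nat_power)
    then have "real l \<le> log 2 (real n)"
      using \<open>0 < n\<close> by (simp add: le_log_iff powr_realpow)
    then show ?thesis
      unfolding s_def by linarith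
  qed
  then have "streaming_reducible (\<lambda>_. Suc K * m) s \<Sigma> (\<lambda>x. x \<in> L) UNIV (\<lambda>y. y \<in> one_turn_Dyck2)"
    unfolding P(2) by (intro streaming_reducible_Dyck) (auto simp: s_def)
  moreover have "(\<lambda>n. real (s n)) \<in> O(\<lambda>n. log 2 (real n))"
  \<comment> \<open>From \<open>n = 2\<close> on the logarithm is at least 1, so the summand 2 costs
    at most twice the logarithm.\<close>
  proof (rule bigoI[where c = 3])
    have "norm (real (s n)) \<le> 3 * norm (log 2 (real n))" if "2 \<le> n" for n
    proof -
      have "1 \<le> log 2 (real n)"
        using that by (simp add: le_log_iff)
      then show ?thesis
        unfolding s_def real_norm_def by linarith
    qed
    then show "\<forall>\<^sub>F n in at_top. norm (real (s n)) \<le> 3 * norm (log 2 (real n))"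
      using eventually_at_top_linorder by blast
  qed
  moreover have "real (Suc K * m) \<le> 2 * real (Suc K) * log 2 (real (card \<Sigma>))"
    using mult_left_mono[OF nat_ceiling_log2_card(2)[of "card \<Sigma>"], of "real (Suc K)"]
    unfolding m_def by (simp only: of_nat_mult mult_ac)
  ultimately show "\<exists>f s. (\<forall>n. real (f n) \<le> 2 * real (Suc (dlin_width \<Sigma> L)) * log 2 (real (card \<Sigma>))) \<and>
      (\<lambda>n. real (s n)) \<in> O(\<lambda>n. log 2 (real n)) \<and>
      streaming_reducible f s \<Sigma> (\<lambda>x. x \<in> L) UNIV (\<lambda>y. y \<in> one_turn_Dyck2)"
    unfolding K_def by (intro exI conjI allI)
qed

end
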